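(* Let $U_x, U_y$ be real numbers with $0 < U_x \le 1$ and $0 < U_y \le 1$, and let $D = [0,U_x]\times[0,U_y]$. Let $f_3 : D \to \mathbb{R}$ be given by $f_3(x,y) = \dfrac{xy}{x+y-xy}$ for $(x,y)\neq(0,0)$ and $f_3(0,0)=0$. Then the concave envelope of $f_3$ over $D$ is the function $f_3^{ave} : D \to \mathbb{R}$ given by $$f_3^{ave}(x,y) = \begin{cases} \dfrac{xy}{x+y-U_x\, y} & \text{if } \dfrac{x}{U_x} \ge \dfrac{y}{U_y},\\[2ex] \dfrac{xy}{x+y-x\,U_y} & \text{otherwise,}\end{cases}$$ for $(x,y)\neq(0,0)$, and $f_3^{ave}(0,0)=0$.
   Context: The concave envelope of a function $f : D \to \mathbb{R}$ over a convex set $D \subseteq \mathbb{R}^2$ is the smallest concave overestimator of $f$ on $D$: the function $f^{ave} : D \to \mathbb{R}$ that is concave on $D$, satisfies $f^{ave}(x,y) \ge f(x,y)$ for all $(x,y)\in D$, and satisfies $f^{ave}(x,y) \le g(x,y)$ for all $(x,y) \in D$ and every concave function $g : D \to \mathbb{R}$ with $g \ge f$ on $D$. *)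

theory Defs
  imports "HOL-Analysis.Analysis"
begin

text \<open>A function on \<^term>\<open>D\<close> is represented by a total function of which only the values
  on \<^term>\<open>D\<close> matter. Convexity of \<^term>\<open>D\<close> is part of \<^const>\<open>concave_on\<close>.\<close>

definition is_concave_envelope ::
    "'a::real_vector set \<Rightarrow> ('a \<Rightarrow> real) \<Rightarrow> ('a \<Rightarrow> real) \<Rightarrow> bool" where
  "is_concave_envelope D f h \<longleftrightarrow>
     concave_on D h \<and> (\<forall>p\<in>D. f p \<le> h p) \<and>
     (\<forall>g. concave_on D g \<and> (\<forall>p\<in>D. f p \<le> g p) \<longrightarrow> (\<forall>p\<in>D. h p \<le> g p))"

lemma is_concave_envelope_unique:
  assumes "is_concave_envelope D f h" "is_concave_envelope D f h'" "p \<in> D"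
  shows "h p = h' p"
  using assms unfolding is_concave_envelope_def by (meson order_antisym)

definition f3 :: "real \<times> real \<Rightarrow> real" where
  "f3 = (\<lambda>(x, y). if (x, y) = (0, 0) then 0 else x * y / (x + y - x * y))"

definition f3_ave :: "real \<Rightarrow> real \<Rightarrow> real \<times> real \<Rightarrow> real" where
  "f3_ave Ux Uy = (\<lambda>(x, y).
     if (x, y) = (0, 0) then 0
     else if x / Ux \<ge> y / Uy then x * y / (x + y - Ux * y)
     else x * y / (x + y - x * Uy))"

end

(* On D, f3_ave is the minimum of the two functions xy/(x + (1 - Ux) y) and
   xy/((1 - Uy) x + y). Both are positively homogeneous and superadditive on the quadrant,
   hence so is their minimum, which is therefore concave. Conversely, f3_ave agrees with f3 at
   the origin and on the sides x = Ux and y = Uy and is linear on the segments joining the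
   origin to those sides, so no smaller function above f3 is concave. *)
theory Submission
  imports Defs
begin

text \<open>Superadditivity is asked at multiples of points of \<open>S\<close>, not on
  \<open>S\<close>: homogeneity turns the weights of a convex combination into such multiples. In
  this form \<open>S\<close> need not be a cone, so a rectangle qualifies.\<close>

lemma concave_on_homogeneous_superadditive:
  fixes h :: "'a::real_vector \<Rightarrow> real"
  assumes "convex S"
    and scale: "\<And>c p. p \<in> S \<Longrightarrow> 0 \<le> c \<Longrightarrow> h (c *\<^sub>R p) = c * h p"
    and add: "\<And>a b p q. p \<in> S \<Longrightarrow> q \<in> S \<Longrightarrow> 0 \<le> a \<Longrightarrow> 0 \<le> b \<Longrightarrow>
      h (a *\<^sub>R p) + h (b *\<^sub>R q) \<le> h (a *\<^sub>R p + b *\<^sub>R q)"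
  shows "concave_on S h"
  unfolding concave_on_iff using \<open>convex S\<close> by (metis scale add)

lemma concave_on_ge_scaled:
  fixes g :: "'a::real_vector \<Rightarrow> real"
  assumes "concave_on S g" "0 \<in> S" "0 \<le> g 0" "p \<in> S" "0 \<le> c" "c \<le> 1"
  shows "c * g p \<le> g (c *\<^sub>R p)"
proof -
  have "0 \<le> 1 - c" "c + (1 - c) = 1" using assms by simp_all
  then have "c * g p + (1 - c) * g 0 \<le> g (c *\<^sub>R p + (1 - c) *\<^sub>R 0)"
    using assms unfolding concave_on_iff by blast
  moreover have "0 \<le> (1 - c) * g 0" using assms by simp
  ultimately show ?thesis by simp
qed

text \<open>Vanishing denominators (with \<open>x / 0 = 0\<close>) do occur in the application: if \<open>Ux = 1\<close>,
  then \<open>x + (1 - Ux) * y\<close> is \<open>0\<close> on the whole edge \<open>x = 0\<close>.\<close>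

lemma product_over_linear_superadditive:
  fixes a b :: real
  assumes nn: "0 \<le> a" "0 \<le> b" "0 \<le> x" "0 \<le> y" "0 \<le> x'" "0 \<le> y'"
  shows "x * y / (a * x + b * y) + x' * y' / (a * x' + b * y')
    \<le> (x + x') * (y + y') / (a * (x + x') + b * (y + y'))"
proof -
  \<comment> \<open>If one denominator vanishes, its fraction is 0 and the other denominator equals
    that of the sum, so only numerators need comparing.\<close>
  have degenerate: "u' * v' / (a * u' + b * v')
      \<le> (u + u') * (v + v') / (a * (u + u') + b * (v + v'))"
    if "a * u + b * v = 0" "0 \<le> u" "0 \<le> v" "0 \<le> u'" "0 \<le> v'" for u v u' v' :: real
  proof -
    have "a * (u + u') + b * (v + v') = a * u' + b * v'"
      using that(1) by (simp add: algebra_simps)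
    moreover have "u' * v' \<le> (u + u') * (v + v')"
      using that by (intro mult_mono) auto
    ultimately show ?thesis
      using that nn by (auto intro!: divide_right_mono)
  qed
  define d d' where "d = a * x + b * y" and "d' = a * x' + b * y'"
  have "0 \<le> d" "0 \<le> d'" using nn by (auto simp: d_def d'_def)
  then consider "d = 0" | "d' = 0" | "0 < d" "0 < d'" by linarith
  then show ?thesis
  proof cases
    case 1
    then show ?thesis using degenerate[of x y x' y'] nn by (simp add: d_def)
  next
    case 2
    then show ?thesis using degenerate[of x' y' x y] nn by (simp add: d'_def add.commute)
  next
    case 3
    \<comment> \<open>The difference factors as
      \<open>(x * d' - x' * d) * (y' * d - y * d')\<close>, and these factors are \<open>b\<close>
      and \<open>a\<close> times \<open>x * y' - x' * y\<close>.\<close>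
    have "(x + x') * (y + y') * (d * d') - (x * y * d' + x' * y' * d) * (d + d')
        = a * b * (x * y' - x' * y)\<^sup>2"
      by (simp add: d_def d'_def algebra_simps power2_eq_square)
    moreover have "0 \<le> a * b * (x * y' - x' * y)\<^sup>2" using nn by simp
    ultimately have "(x * y * d' + x' * y' * d) * (d + d') \<le> (x + x') * (y + y') * (d * d')"
      by linarith
    then have "(x * y * d' + x' * y' * d) / (d * d') \<le> (x + x') * (y + y') / (d + d')"
      using 3 by (simp add: divide_le_eq pos_le_divide_eq field_simps)
    moreover have "(x * y * d' + x' * y' * d) / (d * d') = x * y / d + x' * y' / d'"
      using 3 by (simp add: field_simps)
    ultimately show ?thesis by (simp add: d_def d'_def algebra_simps)
  qed
qed

text \<open>Both fractions have the same numerator, so the smaller one has the larger denominator,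
  and comparing denominators is exactly the branch condition. The factors \<open>1 *\<close> match
  the pattern \<open>a * x + b * y\<close> of
  \<open>product_over_linear_superadditive\<close>.\<close>

lemma f3_ave_eq_min:
  assumes "0 < Ux" "Ux \<le> 1" "0 < Uy" "Uy \<le> 1" "0 \<le> x" "0 \<le> y"
  shows "f3_ave Ux Uy (x, y)
    = min (x * y / (1 * x + (1 - Ux) * y)) (x * y / ((1 - Uy) * x + 1 * y))"
proof (cases "x = 0 \<or> y = 0")
  case True
  then show ?thesis by (auto simp: f3_ave_def)
next
  case False
  then have xy: "0 < x" "0 < y" using assms by auto
  define d e where "d = x + y - Ux * y" and "e = x + y - x * Uy"
  have "Ux * y \<le> y" "x * Uy \<le> x"
    using assms by (simp_all add: mult_left_le_one_le mult_right_le_one_le)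
  then have de: "0 < d" "0 < e" using xy unfolding d_def e_def by linarith+
  have iff: "x / Ux \<ge> y / Uy \<longleftrightarrow> e \<le> d"
    using assms by (simp add: d_def e_def field_simps)
  have "x * y / d \<le> x * y / e \<longleftrightarrow> e \<le> d"
    using xy de by (simp add: divide_le_cancel field_simps)
  then have "f3_ave Ux Uy (x, y) = min (x * y / d) (x * y / e)"
    using xy iff by (simp add: f3_ave_def min_def flip: d_def e_def)
  moreover have "d = 1 * x + (1 - Ux) * y" "e = (1 - Uy) * x + 1 * y"
    by (simp_all add: d_def e_def algebra_simps)
  ultimately show ?thesis by simp
qed

lemma f3_ave_scale:
  assumes "0 \<le> c" "0 < Ux" "0 < Uy"
  shows "f3_ave Ux Uy (c *\<^sub>R p) = c * f3_ave Ux Uy p"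
proof (cases "c = 0")
  case True
  then show ?thesis by (cases p) (simp add: f3_ave_def)
next
  case False
  obtain x y where p: "p = (x, y)" by (cases p)
  have c: "0 < c" using False assms by simp
  have 1: "c * x / Ux \<ge> c * y / Uy \<longleftrightarrow> x / Ux \<ge> y / Uy"
    using c mult_le_cancel_left_pos[of c "y / Uy" "x / Ux"] by simp
  have 2: "(c * x) * (c * y) / (c * x + c * y - k * (c * y)) = c * (x * y / (x + y - k * y))"
    "(c * x) * (c * y) / (c * x + c * y - c * x * k) = c * (x * y / (x + y - x * k))" for k
  proof -
    have "c * x + c * y - k * (c * y) = c * (x + y - k * y)"
      "c * x + c * y - c * x * k = c * (x + y - x * k)" by (simp_all add: algebra_simps)
    then show "(c * x) * (c * y) / (c * x + c * y - k * (c * y)) = c * (x * y / (x + y - k * y))"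
      "(c * x) * (c * y) / (c * x + c * y - c * x * k) = c * (x * y / (x + y - x * k))"
      using c by simp_all
  qed
  show ?thesis
    using c by (simp only: p scaleR_Pair real_scaleR_def f3_ave_def prod.case 1 2) auto
qed

lemma concave_on_f3_ave:
  assumes "0 < Ux" "Ux \<le> 1" "0 < Uy" "Uy \<le> 1"
  shows "concave_on ({0..Ux} \<times> {0..Uy}) (f3_ave Ux Uy)"
proof (rule concave_on_homogeneous_superadditive)
  show "convex ({0..Ux} \<times> {0..Uy})" by (intro convex_Times convex_real_interval)
  show "f3_ave Ux Uy (c *\<^sub>R p) = c * f3_ave Ux Uy p" if "0 \<le> c" for c p
    using f3_ave_scale that assms by blast
  \<comment> \<open>Stated on the whole quadrant because \<open>a\<close> and \<open>b\<close> are
    arbitrary nonnegative weights, so the scaled points may leave the rectangle. A sum of minima is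
    at most the minimum of the sums.\<close>
  have super: "f3_ave Ux Uy p + f3_ave Ux Uy q \<le> f3_ave Ux Uy (p + q)"
    if "0 \<le> fst p" "0 \<le> snd p" "0 \<le> fst q" "0 \<le> snd q" for p q
  proof -
    obtain x y x' y' where pq: "p = (x, y)" "q = (x', y')" by (cases p, cases q)
    have nn: "0 \<le> x" "0 \<le> y" "0 \<le> x'" "0 \<le> y'" using that pq by auto
    show ?thesis
      using product_over_linear_superadditive[of 1 "1 - Ux" x y x' y']
        product_over_linear_superadditive[of "1 - Uy" 1 x y x' y'] nn assms
      unfolding pq add_Pair by (subst (1 2 3) f3_ave_eq_min) auto
  qed
  show "f3_ave Ux Uy (a *\<^sub>R p) + f3_ave Ux Uy (b *\<^sub>R q) \<le> f3_ave Ux Uy (a *\<^sub>R p + b *\<^sub>R q)"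
    if "p \<in> {0..Ux} \<times> {0..Uy}" "q \<in> {0..Ux} \<times> {0..Uy}" "0 \<le> a" "0 \<le> b" for a b p q
    using that by (intro super) auto
qed

text \<open>Replacing \<open>x\<close> by \<open>Ux\<close>, or \<open>y\<close> by
  \<open>Uy\<close>, in the product \<open>x * y\<close> of the denominator shrinks the denominator.
  It stays positive off the axes since \<open>Ux\<close> and \<open>Uy\<close> are at most
  1.\<close>

lemma f3_le_f3_ave:
  assumes "0 < Ux" "Ux \<le> 1" "0 < Uy" "Uy \<le> 1" "p \<in> {0..Ux} \<times> {0..Uy}"
  shows "f3 p \<le> f3_ave Ux Uy p"
proof -
  obtain x y where p: "p = (x, y)" by (cases p)
  have xy: "0 \<le> x" "x \<le> Ux" "0 \<le> y" "y \<le> Uy" using assms p by auto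
  show ?thesis
  proof (cases "x = 0 \<or> y = 0")
    case True
    then show ?thesis by (auto simp: p f3_def f3_ave_def)
  next
    case False
    then have pos: "0 < x" "0 < y" using xy by auto
    have "Ux * y \<le> y" "x * Uy \<le> x"
      using assms xy by (simp_all add: mult_left_le_one_le mult_right_le_one_le)
    then have "0 < x + y - Ux * y" "0 < x + y - x * Uy"
      using pos by linarith+
    moreover have "x * y \<le> Ux * y" "x * y \<le> x * Uy"
      using xy by (auto intro: mult_right_mono mult_left_mono)
    ultimately show ?thesis
      using pos by (auto simp: p f3_def f3_ave_def intro!: frac_le)
  qed
qed

lemma f3_ave_eq_f3_on_sides:
  assumes "0 < Ux" "0 < Uy"
    and "x = Ux \<and> y \<le> Uy \<or> x \<le> Ux \<and> y = Uy"
  shows "f3_ave Ux Uy (x, y) = f3 (x, y)"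
proof -
  \<comment> \<open>The corner goes to the first case, so that the strict \<open>x < Ux\<close> in
    the second forces the other branch of \<open>f3_ave\<close>.\<close>
  consider "x = Ux" "y \<le> Uy" | "x < Ux" "y = Uy" using assms(3) by fastforce
  then show ?thesis
  proof cases
    case 1
    then have "x / Ux \<ge> y / Uy" using assms by simp
    then show ?thesis using 1 by (simp add: f3_ave_def f3_def)
  next
    case 2
    then have "\<not> x / Ux \<ge> y / Uy" using assms by simp
    then show ?thesis using 2 by (simp add: f3_ave_def f3_def)
  qed
qed

lemma f3_ave_le_concave:
  assumes U: "0 < Ux" "0 < Uy"
    and g: "concave_on ({0..Ux} \<times> {0..Uy}) g"
    and over: "\<And>p. p \<in> {0..Ux} \<times> {0..Uy} \<Longrightarrow> f3 p \<le> g p"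
    and "p \<in> {0..Ux} \<times> {0..Uy}"
  shows "f3_ave Ux Uy p \<le> g p"
proof -
  obtain x y where p: "p = (x, y)" by (cases p)
  have xy: "0 \<le> x" "x \<le> Ux" "0 \<le> y" "y \<le> Uy" using assms p by auto
  have z: "0 \<in> {0..Ux} \<times> {0..Uy}" using U by (simp add: zero_prod_def)
  have g0: "0 \<le> g 0" using over[OF z] by (simp add: zero_prod_def f3_def)
  \<comment> \<open>The gauge of the rectangle at \<open>p\<close>: for \<open>c > 0\<close>,
    dividing by \<open>c\<close> pushes \<open>p\<close> along its ray from the origin onto the side
    \<open>x = Ux\<close> or \<open>y = Uy\<close>.\<close>
  define c where "c = max (x / Ux) (y / Uy)"
  have c01: "0 \<le> c" "c \<le> 1" using U xy by (auto simp: c_def le_max_iff_disj)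
  show ?thesis
  proof (cases "c = 0")
    case True
    then have "x / Ux = 0" "y / Uy = 0"
      using U xy unfolding c_def by (smt (verit) divide_nonneg_pos)+
    then have "p = 0" using U by (simp add: p zero_prod_def)
    then show ?thesis using g0 by (simp add: f3_ave_def zero_prod_def)
  next
    case False
    then have c: "0 < c" using c01 by simp
    have "x / Ux \<le> c" "y / Uy \<le> c" by (simp_all add: c_def)
    then have le: "x / c \<le> Ux" "y / c \<le> Uy" using c U by (simp_all add: field_simps)
    have side: "x / c = Ux \<or> y / c = Uy"
      using c U unfolding c_def max_def by (auto split: if_splits)
    define b where "b = (x / c, y / c)"
    have pb: "p = c *\<^sub>R b" using c by (simp add: p b_def)
    have bD: "b \<in> {0..Ux} \<times> {0..Uy}" using le xy c by (simp add: b_def)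
    have "f3_ave Ux Uy p = c * f3_ave Ux Uy b"
      using f3_ave_scale U c by (simp add: pb)
    also have "f3_ave Ux Uy b = f3 b"
      unfolding b_def by (rule f3_ave_eq_f3_on_sides) (use U le side in auto)
    also have "c * f3 b \<le> c * g b" using over[OF bD] c by simp
    also have "c * g b \<le> g p"
      unfolding pb by (rule concave_on_ge_scaled[OF g z g0 bD c01])
    finally show ?thesis .
  qed
qed

theorem theorem1:
  fixes Ux Uy :: real
  assumes "0 < Ux" "Ux \<le> 1" "0 < Uy" "Uy \<le> 1"
  shows "is_concave_envelope ({0..Ux} \<times> {0..Uy}) f3 (f3_ave Ux Uy)"
  unfolding is_concave_envelope_def
  using assms concave_on_f3_ave f3_le_f3_ave f3_ave_le_concave by blast

end
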